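(* Let $T\in M_{n+1}(\mathbb{C})$ be a Hermitian, positive semidefinite Toeplitz matrix of rank $n$, and let $\xi=(\xi_0,\dots,\xi_n)\in\ker T$ with $\xi\neq 0$. Then all the zeros of the polynomial $$P(z):=\sum_{j=0}^n \xi_j z^j$$ lie on the unit circle $\{z\in\mathbb{C}:|z|=1\}$.
   Context: A Toeplitz matrix is a matrix $(T_{j,k})_{0\le j,k\le n}$ whose entry $T_{j,k}$ depends only on $j-k$. *)

theory Defs
  imports
    Complex_Main
    "Jordan_Normal_Form.DL_Rank"
    "Jordan_Normal_Form.Matrix_Kernel"
    "Jordan_Normal_Form.Schur_Decomposition"
begin

definition toeplitz_mat :: "'a mat \<Rightarrow> bool" where
  "toeplitz_mat A \<longleftrightarrow> square_mat A \<and>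
     (\<exists>t :: int \<Rightarrow> 'a. \<forall>j < dim_row A. \<forall>k < dim_col A. A $$ (j, k) = t (int j - int k))"

definition hermitian_mat :: "complex mat \<Rightarrow> bool" where
  "hermitian_mat A \<longleftrightarrow> square_mat A \<and> mat_adjoint A = A"

(* The order on complex numbers is the partial one: 0 \<le> z means that z is real and nonnegative.
   Since x \<bullet>c y is conjugate-linear in y, the scalar below is v* A v. *)
definition positive_semidefinite_mat :: "complex mat \<Rightarrow> bool" where
  "positive_semidefinite_mat A \<longleftrightarrow> square_mat A \<and>
     (\<forall>v \<in> carrier_vec (dim_col A). 0 \<le> (A *\<^sub>v v) \<bullet>c v)"

end

theory Submission
  imports Defs
begin

text \<open>If \<open>P(z) = 0\<close>, write \<open>P = (X - z) Q\<close> and let \<open>v\<close>, \<open>u\<close> be the coefficient vectors of \<open>Q\<close> and \<open>X Q\<close>,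
so that \<open>\<xi> = u - z v\<close> and \<open>T u = z T v\<close>. As \<open>u\<close> is a shift of \<open>v\<close>, the Toeplitz property gives
\<open>\<langle>T u, u\<rangle> = \<langle>T v, v\<rangle>\<close>, while \<open>T u = z T v\<close> and hermiticity give \<open>\<langle>T u, u\<rangle> = |z|\<^sup>2 \<langle>T v, v\<rangle>\<close>. If
\<open>\<langle>T v, v\<rangle> \<noteq> 0\<close>, this yields \<open>|z| = 1\<close>. Otherwise \<open>T v = 0\<close> by positivity, hence \<open>T u = 0\<close>, and the
linearly independent vectors \<open>u\<close>, \<open>v\<close> contradict \<open>dim (ker T) = 1\<close>.\<close>

text \<open>This is the form in which a one-dimensional kernel is used: a kernel vector is
  determined by one coordinate. A maximal independent set of columns leaves out a single index
  \<open>k\<close>, and a kernel vector with \<open>x $ k = 0\<close> is a linear relation among the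
  remaining, independent columns, hence trivial.\<close>

lemma (in vec_space) kernel_coordinate_if_corank_1:
  assumes A: "A \<in> carrier_mat n nc" and rk: "nc = Suc (rank A)"
  obtains k where "k < nc"
    and "\<And>x. x \<in> mat_kernel A \<Longrightarrow> x $ k = 0 \<Longrightarrow> x = 0\<^sub>v nc"
proof -
  obtain S where mx: "maximal S (\<lambda>T. T \<subseteq> set (cols A) \<and> lin_indpt T)"
    using maximal_exists_superset[of "set (cols A)" "\<lambda>T. T \<subseteq> set (cols A) \<and> lin_indpt T" "{}"]
    by (meson List.finite_set empty_subsetI finite_lin_indpt2 empty_iff finite.emptyI)
  then have S: "S \<subseteq> set (cols A)" and li: "lin_indpt S"
    by (auto simp: maximal_def)
  have cardS: "card S = rank A"
    using rank_card_indpt[OF A mx] by simp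
  have finS: "finite S"
    using S finite_subset by blast
  have SV: "S \<subseteq> carrier_vec n"
    using S A cols_dim by blast
  have cov: "S \<subseteq> col A ` {..<nc}"
    using S A by (auto simp: cols_def lessThan_atLeast0)
  \<comment> \<open>\<open>S\<close> is a set of vectors and so forgets repeated columns;
    \<open>J\<close> picks exactly one index for each member of \<open>S\<close>, which makes
    \<open>card J\<close> the rank.\<close>
  then obtain J where J: "J \<subseteq> {..<nc}" "inj_on (col A) J" "S = col A ` J"
    by (meson subset_image_inj)
  have "card J = rank A"
    using J cardS card_image by metis
  then obtain k where k: "k < nc" "{..<nc} - J = {k}"
    using J(1) rk card_Diff_subset[of J "{..<nc}"] finite_subset[OF J(1)]
    by (auto simp: card_1_singleton_iff)
  then have J_eq: "J = {..<nc} - {k}"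
    using J(1) by auto
  show thesis
  proof (rule that[OF k(1)])
    fix x assume x: "x \<in> mat_kernel A" and xk: "x $ k = 0"
    note xc = mat_kernelD[OF A x]
    \<comment> \<open>The coordinates of \<open>x\<close> become coefficients indexed by the columns
      themselves, as \<open>lincomb\<close> expects.\<close>
    define a where "a c = x $ the_inv_into J (col A) c" for c
    have a: "a (col A j) = x $ j" if "j \<in> J" for j
      using J(2) that by (simp add: a_def the_inv_into_f_f)
    have "lincomb a S = 0\<^sub>v n"
    proof (rule eq_vecI)
      fix i assume "i < dim_vec (0\<^sub>v n :: 'a vec)"
      then have i: "i < n" by simp
      have "lincomb a S $ i = (\<Sum>c\<in>S. a c * c $ i)"
        using lincomb_index[OF i SV] .
      also have "\<dots> = (\<Sum>j\<in>J. x $ j * col A j $ i)"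
        using J a by (simp add: sum.reindex)
      also have "\<dots> = (\<Sum>j\<in>{..<nc}. x $ j * col A j $ i)"
        using J(1) J_eq xk by (intro sum.mono_neutral_left) auto
      also have "\<dots> = (A *\<^sub>v x) $ i"
        using A i xc(1) by (auto simp: scalar_prod_def lessThan_atLeast0 mult.commute intro!: sum.cong)
      finally show "lincomb a S $ i = 0\<^sub>v n $ i"
        using xc(2) i by simp
    qed (use SV lincomb_dim[OF finS SV] in auto)
    then have "a c = 0" if "c \<in> S" for c
      using not_lindepD[OF li finS order_refl, of a] that by auto
    then have "x $ j = 0" if "j \<in> J" for j
      using a J(3) that by force
    then show "x = 0\<^sub>v nc"
      using xc(1) xk J_eq by (intro eq_vecI) (metis DiffI index_zero_vec lessThan_iff singletonD, auto)
  qed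
qed

lemma hermitian_mat_index:
  assumes "hermitian_mat A" "i < dim_row A" "j < dim_row A"
  shows "cnj (A $$ (i, j)) = A $$ (j, i)"
proof -
  have sq: "dim_col A = dim_row A" and "mat_adjoint A = A"
    using assms by (auto simp: hermitian_mat_def)
  then have "A $$ (j, i) = mat_adjoint A $$ (j, i)"
    by simp
  also have "\<dots> = cnj (A $$ (i, j))"
    using assms sq by (simp add: mat_adjoint_def mat_of_rows_index)
  finally show ?thesis ..
qed

lemma mult_mat_vec_cscalar_prod:
  assumes "A \<in> carrier_mat n n" "x \<in> carrier_vec n" "y \<in> carrier_vec n"
  shows "(A *\<^sub>v x) \<bullet>c y = (\<Sum>i<n. \<Sum>j<n. A $$ (i, j) * x $ j * cnj (y $ i))"
  using assms
  by (auto simp: scalar_prod_def lessThan_atLeast0 sum_distrib_right intro!: sum.cong)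

lemma hermitian_mat_cscalar_prod:
  assumes A: "A \<in> carrier_mat n n" and "hermitian_mat A"
    and x: "x \<in> carrier_vec n" and y: "y \<in> carrier_vec n"
  shows "(A *\<^sub>v x) \<bullet>c y = cnj ((A *\<^sub>v y) \<bullet>c x)"
proof -
  have "cnj ((A *\<^sub>v y) \<bullet>c x) = (\<Sum>i<n. \<Sum>j<n. A $$ (j, i) * cnj (y $ j) * x $ i)"
    using A hermitian_mat_index[OF assms(2)]
    by (simp add: mult_mat_vec_cscalar_prod[OF A y x])
  also have "\<dots> = (A *\<^sub>v x) \<bullet>c y"
    by (subst sum.swap) (simp add: mult_mat_vec_cscalar_prod[OF A x y] mult_ac)
  finally show ?thesis ..
qed

text \<open>Perturb \<open>v\<close> in the direction \<open>w = A v\<close>. For real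
  \<open>s\<close> the form at \<open>v + s w\<close> equals \<open>2 s a + s^2 b\<close> with
  \<open>a = |w|^2\<close>; its linear term would make it negative for small negative
  \<open>s\<close> unless \<open>a = 0\<close>.\<close>

lemma positive_semidefinite_mat_isotropic:
  assumes A: "A \<in> carrier_mat n n" and herm: "hermitian_mat A"
    and psd: "positive_semidefinite_mat A"
    and v: "v \<in> carrier_vec n" and v0: "(A *\<^sub>v v) \<bullet>c v = 0"
  shows "A *\<^sub>v v = 0\<^sub>v n"
proof -
  define w where "w = A *\<^sub>v v"
  have w: "w \<in> carrier_vec n" using A v by (simp add: w_def)
  have nn: "0 \<le> (A *\<^sub>v y) \<bullet>c y" if "y \<in> carrier_vec n" for y
    using psd A that by (auto simp: positive_semidefinite_mat_def)
  define a where "a = Re (w \<bullet>c w)"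
  define b where "b = Re ((A *\<^sub>v w) \<bullet>c w)"
  have vw: "(A *\<^sub>v v) \<bullet>c w = of_real a"
    using conjugate_square_ge_0_vec[of w]
    by (simp add: w_def a_def complex_eq_iff less_eq_complex_def)
  have wv: "(A *\<^sub>v w) \<bullet>c v = of_real a"
    using hermitian_mat_cscalar_prod[OF A herm w v] vw by simp
  have ww: "(A *\<^sub>v w) \<bullet>c w = of_real b" and b: "0 \<le> b"
    using nn[OF w] by (auto simp: b_def complex_eq_iff less_eq_complex_def)
  have quad: "0 \<le> 2 * s * a + s\<^sup>2 * b" for s :: real
  proof -
    have "(A *\<^sub>v (v + of_real s \<cdot>\<^sub>v w)) \<bullet>c (v + of_real s \<cdot>\<^sub>v w)
      = (A *\<^sub>v v) \<bullet>c v + of_real s * ((A *\<^sub>v w) \<bullet>c v) + of_real s * ((A *\<^sub>v v) \<bullet>c w)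
        + of_real s * of_real s * ((A *\<^sub>v w) \<bullet>c w)"
      using v w
      by (simp add: mult_mat_vec_cscalar_prod[OF A],
          unfold sum_distrib_left sum.distrib[symmetric],
          intro sum.cong refl, simp add: algebra_simps)
    also have "\<dots> = of_real (2 * s * a + s\<^sup>2 * b)"
      by (simp add: v0 vw wv ww power2_eq_square)
    finally show ?thesis
      using nn[of "v + of_real s \<cdot>\<^sub>v w"] v w by (simp add: less_eq_complex_def)
  qed
  have "a = 0"
  proof (rule ccontr)
    assume "a \<noteq> 0"
    \<comment> \<open>The minimum is at \<open>s = - a / b\<close>; the denominator
      \<open>b + 1\<close> also covers \<open>b = 0\<close> and still gives the negative value
      \<open>- r^2 (b + 2)\<close> at \<open>s = - r\<close>.\<close>
    define r where "r = a / (b + 1)"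
    have a_eq: "a = r * (b + 1)"
      using b by (simp add: r_def)
    then have "0 < r\<^sup>2 * (b + 2)"
      using b \<open>a \<noteq> 0\<close> by auto
    moreover have "2 * (- r) * a + (- r)\<^sup>2 * b = - (r\<^sup>2 * (b + 2))"
      by (simp add: a_eq power2_eq_square algebra_simps)
    ultimately show False
      using quad[of "- r"] by linarith
  qed
  then have "w \<bullet>c w = 0"
    using vw by (simp add: w_def)
  then show ?thesis
    using w by (simp add: w_def)
qed

text \<open>The zero \<open>u $ 0\<close> removes the first row and column from the form at
  \<open>u\<close>, the zero \<open>v $ n\<close> the last ones from the form at \<open>v\<close>.
  The two remaining blocks of size \<open>n\<close> agree, since moving both indices by one
  preserves their difference.\<close>

lemma toeplitz_mat_shift:
  fixes A :: "complex mat"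
  assumes A: "A \<in> carrier_mat (Suc n) (Suc n)" and "toeplitz_mat A"
    and u: "u \<in> carrier_vec (Suc n)" and v: "v \<in> carrier_vec (Suc n)"
    and "u $ 0 = 0" "v $ n = 0" "\<And>i. i < n \<Longrightarrow> u $ Suc i = v $ i"
  shows "(A *\<^sub>v u) \<bullet>c u = (A *\<^sub>v v) \<bullet>c v"
proof -
  obtain t where t: "\<And>i j. i < Suc n \<Longrightarrow> j < Suc n \<Longrightarrow> A $$ (i, j) = t (int i - int j)"
    using assms by (auto simp: toeplitz_mat_def)
  have "(A *\<^sub>v u) \<bullet>c u = (\<Sum>i<n. \<Sum>j<n. A $$ (Suc i, Suc j) * v $ j * cnj (v $ i))"
    unfolding mult_mat_vec_cscalar_prod[OF A u u] sum.lessThan_Suc_shift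
    using assms by simp
  also have "\<dots> = (A *\<^sub>v v) \<bullet>c v"
    unfolding mult_mat_vec_cscalar_prod[OF A v v] sum.lessThan_Suc
    using assms by (simp add: t)
  finally show ?thesis .
qed

theorem corollary1p1:
  fixes n :: nat and T :: "complex mat" and \<xi> :: "complex vec"
  assumes "T \<in> carrier_mat (n + 1) (n + 1)"
    and "hermitian_mat T"
    and "positive_semidefinite_mat T"
    and "toeplitz_mat T"
    and "vec_space.rank (n + 1) T = n"
    and "\<xi> \<in> mat_kernel T"
    and "\<xi> \<noteq> 0\<^sub>v (n + 1)"
  defines "P \<equiv> (\<Sum>j = 0..n. monom (\<xi> $ j) j)"
  shows "{z. poly P z = 0} \<subseteq> {z. cmod z = 1}"
proof safe
  fix z assume root: "poly P z = 0"
  have T: "T \<in> carrier_mat (Suc n) (Suc n)"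
    using assms(1) by simp
  note xi = mat_kernelD[OF T assms(6)]
  have coeff_P: "coeff P i = (if i \<le> n then \<xi> $ i else 0)" for i
    by (simp add: P_def coeff_sum)
  have "P \<noteq> 0"
  proof
    assume "P = 0"
    then have "\<xi> $ i = 0" if "i < Suc n" for i
      using coeff_P[of i] that by simp
    then have "\<xi> = 0\<^sub>v (n + 1)"
      using xi(1) by (intro eq_vecI) auto
    with assms(7) show False ..
  qed
  obtain Q where PQ: "P = [:- z, 1:] * Q"
    using root by (auto simp: poly_eq_0_iff_dvd)
  then have "Q \<noteq> 0"
    using \<open>P \<noteq> 0\<close> by auto
  have "degree P \<le> n"
    by (rule degree_le) (simp add: coeff_P)
  \<comment> \<open>The strict bound makes \<open>v $ n = 0\<close>, so that the shift
    \<open>u\<close> loses no coefficient of \<open>X Q\<close>.\<close>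
  then have degQ: "degree Q < n"
    using PQ \<open>Q \<noteq> 0\<close> by (simp add: degree_mult_eq del: mult_pCons_left)
  define v where "v = vec (Suc n) (coeff Q)"
  define u where "u = vec (Suc n) (coeff (pCons 0 Q))"
  have v: "v \<in> carrier_vec (Suc n)" and u: "u \<in> carrier_vec (Suc n)"
    by (auto simp: v_def u_def)
  have xi_eq: "\<xi> = u - z \<cdot>\<^sub>v v"
  proof (rule eq_vecI)
    fix i assume "i < dim_vec (u - z \<cdot>\<^sub>v v)"
    then have i: "i < Suc n" by (simp add: v_def)
    have "\<xi> $ i = coeff P i"
      using i by (simp add: coeff_P)
    also have "\<dots> = coeff (pCons 0 Q) i - z * coeff Q i"
      by (simp add: PQ)
    finally show "\<xi> $ i = (u - z \<cdot>\<^sub>v v) $ i"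
      using i by (simp add: u_def v_def)
  qed (use xi u v in auto)
  have Tv: "T *\<^sub>v v \<in> carrier_vec (Suc n)"
    using T v by (auto intro: mult_mat_vec_carrier)
  have "T *\<^sub>v \<xi> = T *\<^sub>v u - z \<cdot>\<^sub>v (T *\<^sub>v v)"
    unfolding xi_eq using T u v
    by (simp add: mult_minus_distrib_mat_vec mult_mat_vec)
  then have diff0: "T *\<^sub>v u - z \<cdot>\<^sub>v (T *\<^sub>v v) = 0\<^sub>v (Suc n)"
    using xi(2) by simp
  have Tu_eq: "T *\<^sub>v u = z \<cdot>\<^sub>v (T *\<^sub>v v)"
  proof (rule eq_vecI)
    fix i assume "i < dim_vec (z \<cdot>\<^sub>v (T *\<^sub>v v))"
    then have "i < Suc n" using T by simp
    then show "(T *\<^sub>v u) $ i = (z \<cdot>\<^sub>v (T *\<^sub>v v)) $ i"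
      using arg_cong[OF diff0, of "\<lambda>x. x $ i"] T by simp
  qed (use T in simp)
  define c where "c = (T *\<^sub>v v) \<bullet>c v"
  have "c = (T *\<^sub>v u) \<bullet>c u"
    unfolding c_def
    by (rule toeplitz_mat_shift[OF T assms(4) u v, symmetric])
      (use degQ in \<open>auto simp: u_def v_def coeff_eq_0\<close>)
  also have "\<dots> = z * ((T *\<^sub>v v) \<bullet>c u)"
    using Tu_eq Tv u by simp
  also have "(T *\<^sub>v v) \<bullet>c u = cnj (z * c)"
    using hermitian_mat_cscalar_prod[OF T assms(2) v u] Tu_eq Tv v by (simp add: c_def)
  \<comment> \<open>Hermiticity for the pair \<open>v\<close>, \<open>v\<close> says that
    \<open>c\<close> is real.\<close>
  also have "cnj (z * c) = cnj z * c"
    using hermitian_mat_cscalar_prod[OF T assms(2) v v] by (simp add: c_def)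
  also have "z * (cnj z * c) = of_real ((cmod z)\<^sup>2) * c"
    by (simp only: complex_norm_square mult.assoc)
  finally have c_eq: "c = of_real ((cmod z)\<^sup>2) * c" .
  have "c \<noteq> 0"
  proof
    assume "c = 0"
    then have "T *\<^sub>v v = 0\<^sub>v (Suc n)"
      using positive_semidefinite_mat_isotropic[OF T assms(2,3) v] by (simp add: c_def)
    moreover from this have "T *\<^sub>v u = 0\<^sub>v (Suc n)"
      unfolding Tu_eq by auto
    ultimately have ker: "v \<in> mat_kernel T" "u \<in> mat_kernel T"
      using T u v by (auto intro: mat_kernelI)
    obtain k where k: "k < Suc n"
      and kz: "\<And>x. x \<in> mat_kernel T \<Longrightarrow> x $ k = 0 \<Longrightarrow> x = 0\<^sub>v (Suc n)"
      using vec_space.kernel_coordinate_if_corank_1[OF T] assms(5) by auto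
    \<comment> \<open>The combination of \<open>u\<close> and \<open>v\<close> whose coordinate
      \<open>k\<close> cancels.\<close>
    define x where "x = v $ k \<cdot>\<^sub>v u - u $ k \<cdot>\<^sub>v v"
    have "T *\<^sub>v x = 0\<^sub>v (Suc n)"
      using mat_kernelD[OF T ker(1)] mat_kernelD[OF T ker(2)] T
      by (simp add: x_def mult_minus_distrib_mat_vec mult_mat_vec, intro eq_vecI) auto
    then have "x = 0\<^sub>v (Suc n)"
      using k u v T by (intro kz mat_kernelI) (auto simp: x_def)
    \<comment> \<open>At this index \<open>v\<close> vanishes and \<open>u\<close> carries the
      leading coefficient of \<open>Q\<close>, so the entry of \<open>x\<close> is
      \<open>v $ k\<close> times a nonzero number.\<close>
    then have "x $ Suc (degree Q) = 0"
      using degQ by simp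
    then have "v $ k = 0"
      using degQ \<open>Q \<noteq> 0\<close> u v by (auto simp: x_def u_def v_def coeff_eq_0)
    then have "v = 0\<^sub>v (Suc n)"
      using kz ker by blast
    then have "v $ degree Q = 0"
      using degQ by simp
    then show False
      using degQ \<open>Q \<noteq> 0\<close> by (simp add: v_def)
  qed
  with c_eq have "(cmod z)\<^sup>2 = 1"
    by (metis mult_cancel_right1 of_real_eq_1_iff)
  then show "cmod z = 1"
    by (simp add: power2_eq_1_iff) (use norm_ge_zero[of z] in linarith)
qed

end
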